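(* Let $\Gamma$ be a graph with a vertex partition $\{C_1,C_2,C_3,D\}$ such that: (i) $|C_1|=|C_2|=|C_3|=2$; write $C_i=\{t_i,b_i\}$. (ii) For every vertex $v\in D$, the numbers of neighbours of $v$ in $C_1$, $C_2$ and $C_3$ are all congruent modulo $2$. (iii) The induced subgraph on $C_1\cup C_2\cup C_3$ has edge set $\{b_1b_2,\ b_2b_3,\ b_1b_3,\ b_1t_2,\ b_2t_3,\ b_3t_1\}$. Let $\pi$ be the permutation of $C_1\cup C_2\cup C_3$ with $\pi(t_i)=t_{i-1}$ and $\pi(b_i)=b_{i-1}$ (indices modulo $3$). Construct $\Gamma'$ from $\Gamma$ on the same vertex set as follows, leaving all other adjacencies unchanged: for every $v\in D$ that has exactly one neighbour $w$ in each $C_i$, replace each such edge $\{v,w\}$ by $\{v,\pi(w)\}$; and replace the induced subgraph on $C_1\cup C_2\cup C_3$ by the graph with edge set $\{b_1b_2,\ b_2b_3,\ b_1b_3,\ b_1t_3,\ b_2t_1,\ b_3t_2\}$. Then $\Gamma'$ is $\mathbb{R}$-cospectral with $\Gamma$.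
   Context: Graphs are finite, simple and loopless. Two graphs with adjacency matrices $A$ and $A'$ are $\mathbb{R}$-cospectral if $A+rJ$ and $A'+rJ$ have the same spectrum for every $r\in\mathbb{R}$, where $J$ is the all-ones matrix. *)

theory Defs
  imports
    "Graph_Theory.Graph_Theory"
    "Jordan_Normal_Form.Char_Poly"
    "HOL-Library.Numeral_Type"
    "HOL-Library.Disjoint_Sets"
    "HOL-Number_Theory.Cong"
    "HOL-Combinatorics.Permutations"
    "HOL-Computational_Algebra.Fundamental_Theorem_Algebra"
begin

text \<open>
  A finite simple graph is a \<open>pair_graph\<close>: the undirected edge \<open>{u, v}\<close> is the pair of arcs
  \<open>(u, v)\<close> and \<open>(v, u)\<close>.
\<close>

definition sym_closure :: "'a rel \<Rightarrow> 'a rel" where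
  "sym_closure R = R \<union> R\<inverse>"

definition neighbours_in :: "'a pair_pre_digraph \<Rightarrow> 'a set \<Rightarrow> 'a \<Rightarrow> 'a set" where
  "neighbours_in G S v = {w \<in> S. (v, w) \<in> parcs G}"


definition adjacency_mat :: "'a list \<Rightarrow> 'a pair_pre_digraph \<Rightarrow> real mat" where
  "adjacency_mat vs G =
     mat (length vs) (length vs) (\<lambda>(i, j). if (vs ! i, vs ! j) \<in> parcs G then 1 else 0)"

definition all_ones_mat :: "nat \<Rightarrow> real mat" where
  "all_ones_mat n = mat n n (\<lambda>_. 1)"

text \<open>
  The multiset of all complex eigenvalues, counted with algebraic multiplicity; the constant
  \<open>spectrum\<close> of the library is only the set of eigenvalues.
\<close>

definition spectrum_mset :: "real mat \<Rightarrow> complex multiset" where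
  "spectrum_mset M = proots (char_poly (map_mat complex_of_real M))"

lemma set_spectrum_mset:
  assumes "M \<in> carrier_mat n n"
  shows "set_mset (spectrum_mset M) = {k. eigenvalue (map_mat complex_of_real M) k}"
proof -
  have M: "map_mat complex_of_real M \<in> carrier_mat n n"
    using assms by simp
  have "char_poly (map_mat complex_of_real M) \<noteq> 0"
    using degree_monic_char_poly[OF M] by auto
  then show ?thesis
    by (simp add: spectrum_mset_def eigenvalue_root_char_poly[OF M])
qed

lemma size_spectrum_mset:
  assumes "M \<in> carrier_mat n n"
  shows "size (spectrum_mset M) = n"
proof -
  have "map_mat complex_of_real M \<in> carrier_mat n n"
    using assms by simp
  then show ?thesis
    by (simp add: spectrum_mset_def size_proots_complex degree_monic_char_poly)
qed

text \<open>
  The spectrum does not depend on the enumeration of the vertices used to write down the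
  adjacency matrix; all enumerations are admitted.
\<close>

definition R_cospectral :: "'a pair_pre_digraph \<Rightarrow> 'b pair_pre_digraph \<Rightarrow> bool" where
  "R_cospectral G H \<longleftrightarrow> pair_graph G \<and> pair_graph H \<and>
     (\<forall>us vs. distinct us \<and> set us = pverts G \<and> distinct vs \<and> set vs = pverts H \<longrightarrow>
       (\<forall>r :: real.
         spectrum_mset (adjacency_mat us G + r \<cdot>\<^sub>m all_ones_mat (length us)) =
         spectrum_mset (adjacency_mat vs H + r \<cdot>\<^sub>m all_ones_mat (length vs))))"


text \<open>
  Indices live in the numeral type \<open>3\<close>, the integers modulo 3, with elements \<open>1\<close>, \<open>2\<close>
  and \<open>3 = 0\<close>.
\<close>

definition switching_vertices :: "'a pair_pre_digraph \<Rightarrow> (3 \<Rightarrow> 'a set) \<Rightarrow> 'a set \<Rightarrow> 'a set" where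
  "switching_vertices G C D = {v \<in> D. \<forall>i. card (neighbours_in G (C i) v) = 1}"

definition switching_arcs :: "'a pair_pre_digraph \<Rightarrow> (3 \<Rightarrow> 'a set) \<Rightarrow> 'a set \<Rightarrow> 'a rel" where
  "switching_arcs G C D =
     {(v, w). v \<in> switching_vertices G C D \<and> w \<in> neighbours_in G (\<Union>i. C i) v}"

definition switched_graph ::
  "'a pair_pre_digraph \<Rightarrow> (3 \<Rightarrow> 'a) \<Rightarrow> (3 \<Rightarrow> 'a) \<Rightarrow> ('a \<Rightarrow> 'a) \<Rightarrow> 'a set \<Rightarrow> 'a pair_pre_digraph" where
  "switched_graph G t b \<pi> D =
     (let C = (\<lambda>i. {t i, b i}); U = (\<Union>i. C i); R = switching_arcs G C D in
      \<lparr> pverts = pverts G,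
        parcs = (parcs G - (sym_closure R \<union> U \<times> U))
          \<union> sym_closure {(v, \<pi> w) | v w. (v, w) \<in> R}
          \<union> sym_closure {(b 1, b 2), (b 2, b 3), (b 1, b 3), (b 1, t 3), (b 2, t 1), (b 3, t 2)} \<rparr>)"

end

theory Submission
  imports Defs
begin

text \<open>
  Put \<open>e\<^sub>i = t\<^sub>i + b\<^sub>i\<close> and \<open>f\<^sub>i = t\<^sub>i - b\<^sub>i\<close>, and let \<open>Q\<close> be the orthogonal matrix that fixes every
  \<open>e\<^sub>i\<close> and every vertex of \<open>D\<close> and sends \<open>f\<^sub>i\<close> to \<open>f\<^sub>i\<^sub>-\<^sub>1\<close>; it fixes the all-ones vector. The
  neighbourhood in \<open>C\<^sub>1 \<union> C\<^sub>2 \<union> C\<^sub>3\<close> of a vertex of \<open>D\<close> is a sum of some \<open>e\<^sub>i\<close> in the even case, and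
  half of \<open>\<Sum>e\<^sub>i + \<Sum>\<plusminus>f\<^sub>i\<close> in the odd case, so \<open>Q\<close> acts on it as the switching does. On the
  six vertices \<open>A e\<^sub>i = e\<^sub>i\<^sub>+\<^sub>1 + e\<^sub>i\<^sub>-\<^sub>1 - f\<^sub>i\<^sub>-\<^sub>1\<close> and \<open>A f\<^sub>i = -e\<^sub>i\<^sub>+\<^sub>1\<close>, whereas
  \<open>A' e\<^sub>i = e\<^sub>i\<^sub>+\<^sub>1 + e\<^sub>i\<^sub>-\<^sub>1 - f\<^sub>i\<^sub>+\<^sub>1\<close> and \<open>A' f\<^sub>i = -e\<^sub>i\<^sub>-\<^sub>1\<close>, whence \<open>A' Q = Q A\<close>.
\<close>

section \<open>Cospectrality from an orthogonal intertwining matrix\<close>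

definition adj :: "'a pair_pre_digraph \<Rightarrow> 'a \<Rightarrow> 'a \<Rightarrow> real" where
  "adj G u v = of_bool ((u, v) \<in> parcs G)"

lemma spectrum_mset_similar:
  assumes "similar_mat A B"
  shows "spectrum_mset A = spectrum_mset B"
proof -
  obtain n where "A \<in> carrier_mat n n" "B \<in> carrier_mat n n"
    using similar_matD[OF assms] by auto
  then show ?thesis
    by (simp add: spectrum_mset_def of_real_hom.char_poly_hom char_poly_similar[OF assms])
qed

text \<open>Lets matrices be handled as functions on vertices: a product over list positions becomes
  a sum over the vertex set, free of the enumeration.\<close>

lemma index_mult_mat_kernel:
  assumes "distinct ws" and "i < m" and "j < n"
  shows "(mat m (length ws) (\<lambda>(i, k). f i (ws ! k)) * mat (length ws) n (\<lambda>(k, j). g (ws ! k) j)) $$ (i, j)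
    = (\<Sum>w\<in>set ws. f i w * g w j)"
proof -
  have "(\<Sum>k<length ws. f i (ws ! k) * g (ws ! k) j) = (\<Sum>w\<in>set ws. f i w * g w j)"
    by (rule sum.reindex_bij_betw[OF bij_betw_nth[OF assms(1)]]) auto
  then show ?thesis
    using assms by (simp add: scalar_prod_def atLeast0LessThan)
qed

text \<open>Unit column and row sums give \<open>J Q = J = Q J\<close>, so the relation
  \<open>A Q = Q A'\<close> extends to \<open>A + r J\<close> and \<open>A' + r J\<close> for every
  \<open>r\<close>. Orthogonality of \<open>Q\<close> turns this into a similarity.\<close>

lemma R_cospectral_if_orthogonal:
  fixes q :: "'a \<Rightarrow> 'a \<Rightarrow> real"
  assumes "pair_graph G" and "pair_graph H" and V: "pverts G = V" "pverts H = V"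
    and orth: "\<And>u v. u \<in> V \<Longrightarrow> v \<in> V \<Longrightarrow> (\<Sum>w\<in>V. q u w * q v w) = of_bool (u = v)"
    and row: "\<And>u. u \<in> V \<Longrightarrow> (\<Sum>w\<in>V. q u w) = 1"
    and col: "\<And>v. v \<in> V \<Longrightarrow> (\<Sum>w\<in>V. q w v) = 1"
    and intertwine: "\<And>u v. u \<in> V \<Longrightarrow> v \<in> V \<Longrightarrow>
      (\<Sum>w\<in>V. adj G u w * q w v) = (\<Sum>w\<in>V. q u w * adj H w v)"
  shows "R_cospectral G H"
  unfolding R_cospectral_def
proof (intro conjI allI impI assms(1,2))
  fix us vs and r :: real
  assume "distinct us \<and> set us = pverts G \<and> distinct vs \<and> set vs = pverts H"
  then have us: "distinct us" "set us = V" and vs: "distinct vs" "set vs = V"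
    using V by auto
  define n where "n = length us"
  have n: "length us = n" "length vs = n"
    using us vs distinct_card by (metis n_def)+
  have in_V: "us ! i \<in> V" "vs ! i \<in> V" if "i < n" for i
    using that us vs n nth_mem by metis+
  define M where "M = mat n n (\<lambda>(i, j). adj G (us ! i) (us ! j) + r)"
  define N where "N = mat n n (\<lambda>(i, j). adj H (vs ! i) (vs ! j) + r)"
  \<comment> \<open>Rows follow \<open>us\<close> and columns follow \<open>vs\<close>, so a single
    matrix also absorbs the change of enumeration.\<close>
  define Q where "Q = mat n n (\<lambda>(i, j). q (us ! i) (vs ! j))"
  have carr [simp]: "M \<in> carrier_mat n n" "N \<in> carrier_mat n n" "Q \<in> carrier_mat n n"
    "Q\<^sup>T \<in> carrier_mat n n"
    by (auto simp: M_def N_def Q_def)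
  have QT: "Q\<^sup>T = mat n n (\<lambda>(i, j). q (us ! j) (vs ! i))"
    by (auto simp: Q_def)
  have "(Q * Q\<^sup>T) $$ (i, j) = 1\<^sub>m n $$ (i, j)" if "i < n" "j < n" for i j
    using that index_mult_mat_kernel[OF vs(1) that, of "\<lambda>i. q (us ! i)" "\<lambda>w j. q (us ! j) w"]
      orth[of "us ! i" "us ! j"] in_V us n
    unfolding QT by (simp add: Q_def vs nth_eq_iff_index_eq)
  then have QQT: "Q * Q\<^sup>T = 1\<^sub>m n"
    by (intro eq_matI) (auto simp: Q_def)
  then have QTQ: "Q\<^sup>T * Q = 1\<^sub>m n"
    by (rule mat_mult_left_right_inverse[rotated 2]) simp_all
  have "(M * Q) $$ (i, j) = (Q * N) $$ (i, j)" if "i < n" "j < n" for i j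
  proof -
    have "(M * Q) $$ (i, j) = (\<Sum>w\<in>V. (adj G (us ! i) w + r) * q w (vs ! j))"
      using index_mult_mat_kernel[OF us(1) that,
          of "\<lambda>i w. adj G (us ! i) w + r" "\<lambda>w j. q w (vs ! j)"]
      by (simp add: M_def Q_def us n)
    also have "\<dots> = (\<Sum>w\<in>V. adj G (us ! i) w * q w (vs ! j)) + r * (\<Sum>w\<in>V. q w (vs ! j))"
      by (simp add: distrib_right sum.distrib sum_distrib_left)
    also have "\<dots> = (\<Sum>w\<in>V. q (us ! i) w * adj H w (vs ! j)) + (\<Sum>w\<in>V. q (us ! i) w) * r"
      using intertwine row col in_V that by simp
    also have "\<dots> = (\<Sum>w\<in>V. q (us ! i) w * (adj H w (vs ! j) + r))"
      by (simp add: distrib_left sum.distrib sum_distrib_right)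
    also have "\<dots> = (Q * N) $$ (i, j)"
      using index_mult_mat_kernel[OF vs(1) that,
          of "\<lambda>i w. q (us ! i) w" "\<lambda>w j. adj H w (vs ! j) + r"]
      by (simp add: N_def Q_def vs n)
    finally show ?thesis .
  qed
  then have MQ: "M * Q = Q * N"
    by (intro eq_matI) (auto simp: M_def N_def Q_def)
  have "Q * N * Q\<^sup>T = M * (Q * Q\<^sup>T)"
    unfolding MQ[symmetric] by (rule assoc_mult_mat[of _ n n _ n _ n]) simp_all
  then have M_eq: "M = Q * N * Q\<^sup>T"
    using QQT right_mult_one_mat[of M n n] by simp
  have "similar_mat M N"
    by (intro similar_matI[OF _ QQT QTQ M_eq]) simp
  moreover have "adjacency_mat us G + r \<cdot>\<^sub>m all_ones_mat (length us) = M"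
    by (intro eq_matI) (auto simp: adjacency_mat_def all_ones_mat_def M_def adj_def n)
  moreover have "adjacency_mat vs H + r \<cdot>\<^sub>m all_ones_mat (length vs) = N"
    by (intro eq_matI) (auto simp: adjacency_mat_def all_ones_mat_def N_def adj_def n)
  ultimately show "spectrum_mset (adjacency_mat us G + r \<cdot>\<^sub>m all_ones_mat (length us)) =
      spectrum_mset (adjacency_mat vs H + r \<cdot>\<^sub>m all_ones_mat (length vs))"
    using spectrum_mset_similar by simp
qed

section \<open>Indices modulo 3 and the six switched vertices\<close>

lemma exhaust_mod3:
  fixes i :: 3
  obtains "i = 1" | "i = 2" | "i = 3"
proof (cases i)
  case (of_int z)
  then have "z = 0 \<or> z = 1 \<or> z = 2"
    by auto
  then show ?thesis
    using of_int that by fastforce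
qed

locale triangle_switching =
  fixes G :: "'a pair_pre_digraph"
    and C :: "3 \<Rightarrow> 'a set"
    and D :: "'a set"
    and t b :: "3 \<Rightarrow> 'a"
    and \<pi> :: "'a \<Rightarrow> 'a"
  assumes graph: "pair_graph G"
    and verts: "pverts G = (\<Union>i. C i) \<union> D"
    and disj: "disjoint_family C"
    and disj_D: "(\<Union>i. C i) \<inter> D = {}"
    and C_eq: "\<And>i. C i = {t i, b i}"
    and card_C: "\<And>i. card (C i) = 2"
    and parity: "\<And>v i j. v \<in> D \<Longrightarrow>
           [card (neighbours_in G (C i) v) = card (neighbours_in G (C j) v)] (mod 2)"
    and arcs_U: "arcs (with_proj G \<restriction> (\<Union>i. C i)) =
           sym_closure {(b 1, b 2), (b 2, b 3), (b 1, b 3), (b 1, t 2), (b 2, t 3), (b 3, t 1)}"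
    and \<pi>_t [simp]: "\<And>i. \<pi> (t i) = t (i - 1)"
    and \<pi>_b [simp]: "\<And>i. \<pi> (b i) = b (i - 1)"
begin

definition U :: "'a set" where "U = (\<Union>i. C i)"
abbreviation V :: "'a set" where "V \<equiv> pverts G"
abbreviation S :: "'a set" where "S \<equiv> switching_vertices G C D"
abbreviation G' :: "'a pair_pre_digraph" where "G' \<equiv> switched_graph G t b \<pi> D"

lemma in_U_iff: "u \<in> U \<longleftrightarrow> (\<exists>i. u = t i \<or> u = b i)"
  using C_eq by (auto simp: U_def)

lemma V_eq: "V = U \<union> D" and U_Int_D: "U \<inter> D = {}"
  using verts disj_D by (simp_all add: U_def)

lemma t_in_U [simp]: "t i \<in> U" and b_in_U [simp]: "b i \<in> U"
  using in_U_iff by blast+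

lemma t_notin_D [simp]: "t i \<notin> D" and b_notin_D [simp]: "b i \<notin> D"
  using U_Int_D t_in_U b_in_U by blast+

lemma U_cases:
  assumes "u \<in> U"
  obtains i where "u = t i" | i where "u = b i"
  using assms in_U_iff by blast

lemma V_cases:
  assumes "u \<in> V"
  obtains "u \<in> D" | i where "u = t i" | i where "u = b i"
  using assms V_eq in_U_iff by blast

lemma finite_D: "finite D"
  using pair_fin_digraph.pair_finite_verts[of G] graph V_eq
  by (simp add: pair_graph_def pair_digraph_def)

lemma t_eq_iff [simp]: "t i = t j \<longleftrightarrow> i = j"
  using disj C_eq by (fastforce simp: disjoint_family_on_def)

lemma b_eq_iff [simp]: "b i = b j \<longleftrightarrow> i = j"
  using disj C_eq by (fastforce simp: disjoint_family_on_def)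

text \<open>Within one cell the two vertices differ because the cell has two elements; across cells
  disjointness decides.\<close>

lemma t_neq_b [simp]: "t i \<noteq> b j" "b j \<noteq> t i"
proof -
  show "t i \<noteq> b j"
  proof (cases "i = j")
    case True
    then show ?thesis
      using card_C[of i] C_eq[of i] by auto
  next
    case False
    then show ?thesis
      using disj C_eq by (auto simp: disjoint_family_on_def)
  qed
  then show "b j \<noteq> t i"
    by simp
qed

lemma sum_V: "(\<Sum>w\<in>V. f w) = (\<Sum>i\<in>UNIV. f (t i)) + (\<Sum>i\<in>UNIV. f (b i)) + (\<Sum>w\<in>D. f w)"
  for f :: "'a \<Rightarrow> real"
proof -
  have "U = range t \<union> range b"
    using in_U_iff by auto
  moreover have "sum f (range t) = (\<Sum>i\<in>UNIV. f (t i))" "sum f (range b) = (\<Sum>i\<in>UNIV. f (b i))"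
    by (simp_all add: sum.reindex inj_on_def)
  moreover have "range t \<inter> range b = {}" "(range t \<union> range b) \<inter> D = {}"
    by auto
  ultimately show ?thesis
    using finite_D V_eq by (simp add: sum.union_disjoint)
qed

section \<open>The orthogonal matrix\<close>

text \<open>Half of it is the matrix of the orthogonal projection onto the span of the
  \<open>e\<^sub>i\<close>.\<close>

definition block :: "'a \<Rightarrow> 'a \<Rightarrow> real" where
  "block u v = of_bool (\<exists>i. u \<in> C i \<and> v \<in> C i)"

lemma block_simps [simp]:
  "block (t i) (t j) = of_bool (i = j)" "block (t i) (b j) = of_bool (i = j)"
  "block (b i) (t j) = of_bool (i = j)" "block (b i) (b j) = of_bool (i = j)"
  by (auto simp: block_def C_eq)

text \<open>
  With \<open>P\<close> the orthogonal projection onto the span of the \<open>e\<^sub>i\<close>, this is \<open>P + (1 - P) \<Pi>\<close> on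
  \<open>U\<close>, where \<open>\<Pi>\<close> is the permutation matrix of \<open>\<pi>\<close>.
\<close>
definition q :: "'a \<Rightarrow> 'a \<Rightarrow> real" where
  "q u v = (if u \<in> U \<and> v \<in> U then (block u v - block u (\<pi> v)) / 2 + of_bool (u = \<pi> v)
            else of_bool (u = v))"

lemma q_simps [simp]:
  "q (t i) (t j) = (of_bool (i = j) + of_bool (i = j - 1)) / 2"
  "q (t i) (b j) = (of_bool (i = j) - of_bool (i = j - 1)) / 2"
  "q (b i) (t j) = (of_bool (i = j) - of_bool (i = j - 1)) / 2"
  "q (b i) (b j) = (of_bool (i = j) + of_bool (i = j - 1)) / 2"
  by (simp_all add: q_def)

lemma q_D [simp]:
  assumes "v \<in> D"
  shows "q v u = of_bool (u = v)" "q u v = of_bool (u = v)"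
  using assms U_Int_D by (auto simp: q_def)

text \<open>Covers the deltas that \<open>q_simps\<close> produces along a row (first and third) and
  along a column (second and fourth).\<close>

lemma sum_delta_mod3:
  fixes g :: "3 \<Rightarrow> real"
  shows "(\<Sum>j\<in>UNIV. of_bool (i = j) * g j) = g i" "(\<Sum>j\<in>UNIV. of_bool (j = i) * g j) = g i"
    "(\<Sum>j\<in>UNIV. of_bool (i = j - 1) * g j) = g (i + 1)"
    "(\<Sum>j\<in>UNIV. of_bool (j = i - 1) * g j) = g (i - 1)"
proof -
  have "i = j - 1 \<longleftrightarrow> j = i + 1" for j
    by (auto simp: algebra_simps)
  then show "(\<Sum>j\<in>UNIV. of_bool (i = j) * g j) = g i" "(\<Sum>j\<in>UNIV. of_bool (j = i) * g j) = g i"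
    "(\<Sum>j\<in>UNIV. of_bool (i = j - 1) * g j) = g (i + 1)"
    "(\<Sum>j\<in>UNIV. of_bool (j = i - 1) * g j) = g (i - 1)"
    by (simp_all add: of_bool_def if_distrib[of "\<lambda>x. x * _"] cong: if_cong)
qed

text \<open>A row of \<open>q\<close> at a vertex of \<open>U\<close> is supported on the cells
  \<open>i\<close> and \<open>i + 1\<close>. With its column analogue, this reduces every later sum
  over \<open>V\<close> to at most four terms.\<close>

lemma sum_q_row:
  "(\<Sum>w\<in>V. q (t i) w * g w) = (g (t i) + g (b i) + g (t (i + 1)) - g (b (i + 1))) / 2"
  "(\<Sum>w\<in>V. q (b i) w * g w) = (g (t i) + g (b i) - g (t (i + 1)) + g (b (i + 1))) / 2"
  "u \<in> D \<Longrightarrow> (\<Sum>w\<in>V. q u w * g w) = g u"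
proof -
  have *: "(\<Sum>w\<in>D. q (t i) w * g w) = 0" "(\<Sum>w\<in>D. q (b i) w * g w) = 0"
    by (auto intro!: sum.neutral)
  show "(\<Sum>w\<in>V. q (t i) w * g w) = (g (t i) + g (b i) + g (t (i + 1)) - g (b (i + 1))) / 2"
    "(\<Sum>w\<in>V. q (b i) w * g w) = (g (t i) + g (b i) - g (t (i + 1)) + g (b (i + 1))) / 2"
    using * by (simp_all add: sum_V add_divide_distrib diff_divide_distrib distrib_right left_diff_distrib
        sum.distrib sum_subtractf sum_delta_mod3 flip: sum_divide_distrib)
  assume "u \<in> D"
  moreover from this have "t i \<noteq> u" "b i \<noteq> u" for i
    by auto
  ultimately show "(\<Sum>w\<in>V. q u w * g w) = g u"
    using finite_D by (simp add: sum_V of_bool_def if_distrib[of "\<lambda>x. x * _"] cong: if_cong)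
qed

lemma sum_q_col:
  "(\<Sum>w\<in>V. g w * q w (t i)) = (g (t i) + g (b i) + g (t (i - 1)) - g (b (i - 1))) / 2"
  "(\<Sum>w\<in>V. g w * q w (b i)) = (g (t i) + g (b i) - g (t (i - 1)) + g (b (i - 1))) / 2"
  "u \<in> D \<Longrightarrow> (\<Sum>w\<in>V. g w * q w u) = g u"
proof -
  have *: "(\<Sum>w\<in>D. q w (t i) * g w) = 0" "(\<Sum>w\<in>D. q w (b i) * g w) = 0"
    by (auto intro!: sum.neutral)
  show "(\<Sum>w\<in>V. g w * q w (t i)) = (g (t i) + g (b i) + g (t (i - 1)) - g (b (i - 1))) / 2"
    "(\<Sum>w\<in>V. g w * q w (b i)) = (g (t i) + g (b i) - g (t (i - 1)) + g (b (i - 1))) / 2"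
    unfolding mult.commute[of "g _"]
    using * by (simp_all add: sum_V add_divide_distrib diff_divide_distrib distrib_right left_diff_distrib
        sum.distrib sum_subtractf sum_delta_mod3 flip: sum_divide_distrib)
  assume "u \<in> D"
  then show "(\<Sum>w\<in>V. g w * q w u) = g u"
    using sum_q_row(3)[of u g] by (simp add: mult.commute)
qed

lemma q_orthogonal:
  assumes "u \<in> V" "v \<in> V"
  shows "(\<Sum>w\<in>V. q u w * q v w) = of_bool (u = v)"
  using assms(1)
proof (cases u rule: V_cases)
  case 1
  then show ?thesis
    using sum_q_row(3)[OF 1, of "q v"] by auto
next
  case (2 i)
  show ?thesis
    using assms(2) by (cases v rule: V_cases) (auto simp: sum_q_row 2)
next
  case (3 i)
  show ?thesis
    using assms(2) by (cases v rule: V_cases) (auto simp: sum_q_row 3)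
qed

lemma sum_q:
  assumes "u \<in> V"
  shows "(\<Sum>w\<in>V. q u w) = 1" "(\<Sum>w\<in>V. q w u) = 1"
  using assms sum_q_row[where g = "\<lambda>_. 1"] sum_q_col[where g = "\<lambda>_. 1"]
  by (cases u rule: V_cases; simp)+

section \<open>Adjacencies before and after switching\<close>

lemma sym_parcs: "sym (parcs G)"
  using pair_sym_digraph.pair_sym_arcs[of G] graph
  by (simp add: pair_graph_def pair_pseudo_graph_def symmetric_def)

lemma adj_sym: "adj G u v = adj G v u"
  using sym_parcs by (auto simp: adj_def dest: symD)

text \<open>Makes the edge list uniform in the cyclic index: the \<open>b i\<close> form a triangle
  and \<open>b i\<close> is joined to \<open>t (i + 1)\<close>. Switching turns the latter into
  \<open>t (i - 1)\<close>.\<close>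

lemma adj_G_U [simp]:
  "adj G (t i) (t j) = 0" "adj G (t i) (b j) = of_bool (j = i - 1)"
  "adj G (b i) (t j) = of_bool (i = j - 1)" "adj G (b i) (b j) = of_bool (i \<noteq> j)"
proof -
  have *: "(u, v) \<in> parcs G \<longleftrightarrow> (u, v) \<in> sym_closure
      {(b 1, b 2), (b 2, b 3), (b 1, b 3), (b 1, t 2), (b 2, t 3), (b 3, t 1)}"
    if "u \<in> U" "v \<in> U" for u v
    unfolding arcs_U[symmetric] using that by (auto simp: U_def)
  show "adj G (t i) (t j) = 0" "adj G (t i) (b j) = of_bool (j = i - 1)"
    "adj G (b i) (t j) = of_bool (i = j - 1)" "adj G (b i) (b j) = of_bool (i \<noteq> j)"
    unfolding adj_def *[OF t_in_U t_in_U] *[OF t_in_U b_in_U] *[OF b_in_U t_in_U] *[OF b_in_U b_in_U]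
    by (cases i rule: exhaust_mod3; cases j rule: exhaust_mod3; simp add: sym_closure_def)+
qed

lemma parcs_G': "parcs G' = (parcs G - (sym_closure (switching_arcs G C D) \<union> U \<times> U))
    \<union> sym_closure {(v, \<pi> w) | v w. (v, w) \<in> switching_arcs G C D}
    \<union> sym_closure {(b 1, b 2), (b 2, b 3), (b 1, b 3), (b 1, t 3), (b 2, t 1), (b 3, t 2)}"
  \<comment> \<open>\<open>switched_graph\<close> spells the cells as \<open>{t i, b i}\<close>;
    folding \<open>C_eq\<close> backwards recovers \<open>C\<close>.\<close>
  using C_eq by (simp add: switched_graph_def Let_def U_def flip: C_eq)

lemma switching_arcs_iff:
  "(v, w) \<in> switching_arcs G C D \<longleftrightarrow> v \<in> S \<and> w \<in> U \<and> (v, w) \<in> parcs G"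
  by (auto simp: switching_arcs_def neighbours_in_def U_def)

lemma S_subset_D: "S \<subseteq> D"
  by (auto simp: switching_vertices_def)

lemma \<pi>_in_U: "w \<in> U \<Longrightarrow> \<pi> w \<in> U"
  by (erule U_cases) simp_all

lemma sym_parcs_G': "sym (parcs G')"
proof -
  have "sym (sym_closure R)" for R :: "'a rel"
    by (auto simp: sym_closure_def sym_def)
  then show ?thesis
    unfolding parcs_G' by (auto simp: sym_def dest: symD[OF sym_parcs])
qed

lemma adj_G'_sym: "adj G' u v = adj G' v u"
  using sym_parcs_G' by (auto simp: adj_def dest: symD)

lemma adj_G'_U [simp]:
  "adj G' (t i) (t j) = 0" "adj G' (t i) (b j) = of_bool (j = i + 1)"
  "adj G' (b i) (t j) = of_bool (i = j + 1)" "adj G' (b i) (b j) = of_bool (i \<noteq> j)"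
proof -
  have *: "(u, v) \<in> parcs G' \<longleftrightarrow> (u, v) \<in> sym_closure
      {(b 1, b 2), (b 2, b 3), (b 1, b 3), (b 1, t 3), (b 2, t 1), (b 3, t 2)}"
    if "u \<in> U" "v \<in> U" for u v
  proof -
    \<comment> \<open>Old and new switching arcs have an end in \<open>S\<close>, hence in
      \<open>D\<close>; inside \<open>U\<close> only the new edge list remains.\<close>
    have "u \<notin> S" "v \<notin> S"
      using that S_subset_D U_Int_D by auto
    then show ?thesis
      using that unfolding parcs_G'
      by (auto simp: switching_arcs_iff sym_closure_def)
  qed
  show "adj G' (t i) (t j) = 0" "adj G' (t i) (b j) = of_bool (j = i + 1)"
    "adj G' (b i) (t j) = of_bool (i = j + 1)" "adj G' (b i) (b j) = of_bool (i \<noteq> j)"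
    unfolding adj_def *[OF t_in_U t_in_U] *[OF t_in_U b_in_U] *[OF b_in_U t_in_U] *[OF b_in_U b_in_U]
    by (cases i rule: exhaust_mod3; cases j rule: exhaust_mod3; simp add: sym_closure_def)+
qed

text \<open>Every arc removed or added has an end in \<open>U\<close>.\<close>

lemma adj_G'_D:
  assumes "u \<in> D" "v \<in> D"
  shows "adj G' u v = adj G u v"
proof -
  have "u \<notin> U" "v \<notin> U" "u \<noteq> \<pi> w" "v \<noteq> \<pi> w" if "w \<in> U" for w
    using assms U_Int_D \<pi>_in_U[OF that] by auto
  moreover have "u \<notin> U" "v \<notin> U" "u \<noteq> t i" "u \<noteq> b i" for i
    using assms U_Int_D by auto
  ultimately show ?thesis
    unfolding adj_def parcs_G' by (auto simp: switching_arcs_iff sym_closure_def)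
qed

lemma parcs_G'_D_U:
  assumes "v \<in> D" "w \<in> U"
  shows "(v, w) \<in> parcs G' \<longleftrightarrow>
    (if v \<in> S then \<exists>x\<in>U. (v, x) \<in> parcs G \<and> w = \<pi> x else (v, w) \<in> parcs G)"
proof -
  have "v \<notin> U" "w \<notin> S" "v \<noteq> t i" "v \<noteq> b i" for i
    using assms U_Int_D S_subset_D by auto
  moreover have "v \<noteq> \<pi> x" if "x \<in> U" for x
    using assms U_Int_D \<pi>_in_U[OF that] by auto
  ultimately show ?thesis
    using assms(2) unfolding parcs_G'
    by (auto simp: switching_arcs_iff sym_closure_def)
qed

text \<open>The shift is upwards because \<open>\<pi>\<close> lowers the index: the preimage of
  \<open>t i\<close> is \<open>t (i + 1)\<close>.\<close>

lemma adj_G'_S: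
  assumes "v \<in> S"
  shows "adj G' v (t i) = adj G v (t (i + 1))" "adj G' v (b i) = adj G v (b (i + 1))"
proof -
  have v: "v \<in> D"
    using assms S_subset_D by auto
  have *: "i = j - 1 \<longleftrightarrow> j = i + 1" for j :: 3
    by (auto simp: algebra_simps)
  have "(\<exists>x\<in>U. (v, x) \<in> parcs G \<and> t i = \<pi> x) \<longleftrightarrow> (v, t (i + 1)) \<in> parcs G"
    "(\<exists>x\<in>U. (v, x) \<in> parcs G \<and> b i = \<pi> x) \<longleftrightarrow> (v, b (i + 1)) \<in> parcs G"
    by (auto simp: * elim!: U_cases)
  then show "adj G' v (t i) = adj G v (t (i + 1))" "adj G' v (b i) = adj G v (b (i + 1))"
    using assms by (simp_all add: adj_def parcs_G'_D_U[OF v t_in_U] parcs_G'_D_U[OF v b_in_U])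
qed

lemma adj_G'_not_S:
  assumes "v \<in> D" "v \<notin> S"
  shows "adj G' v (t i) = adj G v (t i)" "adj G' v (b i) = adj G v (b i)"
  using assms parcs_G'_D_U[OF assms(1) t_in_U] parcs_G'_D_U[OF assms(1) b_in_U]
  by (simp_all add: adj_def)

section \<open>Parity and the intertwining relation\<close>

lemma card_neighbours_C: "real (card (neighbours_in G (C i) v)) = adj G v (t i) + adj G v (b i)"
proof -
  have "neighbours_in G (C i) v = {w \<in> {t i}. (v, w) \<in> parcs G} \<union> {w \<in> {b i}. (v, w) \<in> parcs G}"
    by (auto simp: neighbours_in_def C_eq)
  moreover have "card ({w \<in> {t i}. (v, w) \<in> parcs G} \<union> {w \<in> {b i}. (v, w) \<in> parcs G}) =
      card {w \<in> {t i}. (v, w) \<in> parcs G} + card {w \<in> {b i}. (v, w) \<in> parcs G}"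
    by (rule card_Un_disjoint) auto
  moreover have "{w \<in> {x}. (v, w) \<in> parcs G} = (if (v, x) \<in> parcs G then {x} else {})" for x
    by auto
  ultimately show ?thesis
    by (simp add: adj_def)
qed

lemma adj_S:
  assumes "v \<in> S"
  shows "adj G v (b i) = 1 - adj G v (t i)"
  using assms card_neighbours_C[of i v] by (simp add: switching_vertices_def)

text \<open>If the values differed on one cell, that cell would contain exactly one neighbour. By
  parity all three counts would be odd, and being at most 2 they would all be 1, putting
  \<open>v\<close> in \<open>S\<close>.\<close>

lemma adj_not_S:
  assumes "v \<in> D" "v \<notin> S"
  shows "adj G v (b i) = adj G v (t i)"
proof (rule ccontr)
  assume "adj G v (b i) \<noteq> adj G v (t i)"
  then have "card (neighbours_in G (C i) v) = 1"
    using card_neighbours_C[of i v] by (simp add: adj_def of_bool_def split: if_splits)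
  then have "odd (card (neighbours_in G (C j) v))" for j
    using parity[OF assms(1), of i j] by (simp add: cong_def odd_iff_mod_2_eq_one)
  moreover have "card (neighbours_in G (C j) v) \<le> 2" for j
  proof -
    have "real (card (neighbours_in G (C j) v)) \<le> 2"
      unfolding card_neighbours_C by (simp add: adj_def)
    then show ?thesis
      by simp
  qed
  ultimately have "card (neighbours_in G (C j) v) = 1" for j
    by (metis One_nat_def even_numeral le_Suc_eq le_zero_eq numeral_2_eq_2 odd_pos not_gr_zero)
  then show False
    using assms by (simp add: switching_vertices_def)
qed

text \<open>The entries of \<open>A' Q = Q A\<close> with row in \<open>D\<close> and column in
  \<open>U\<close>. Off \<open>S\<close> the difference term vanishes; on \<open>S\<close> the first
  two terms add up to 1 and the shifted difference undoes \<open>\<pi>\<close>.\<close>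

lemma adj_G'_eq_col:
  assumes "v \<in> D"
  shows
    "(adj G' v (t i) + adj G' v (b i) + adj G' v (t (i - 1)) - adj G' v (b (i - 1))) / 2 = adj G v (t i)"
    "(adj G' v (t i) + adj G' v (b i) - adj G' v (t (i - 1)) + adj G' v (b (i - 1))) / 2 = adj G v (b i)"
  using assms by (cases "v \<in> S"; simp add: adj_G'_S adj_G'_not_S adj_S adj_not_S)+

lemma adj_G'_eq_row:
  assumes "v \<in> D"
  shows
    "(adj G v (t i) + adj G v (b i) + adj G v (t (i + 1)) - adj G v (b (i + 1))) / 2 = adj G' v (t i)"
    "(adj G v (t i) + adj G v (b i) - adj G v (t (i + 1)) + adj G v (b (i + 1))) / 2 = adj G' v (b i)"
  using assms by (cases "v \<in> S"; simp add: adj_G'_S adj_G'_not_S adj_S adj_not_S)+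

lemma adj_intertwine:
  assumes "u \<in> V" "v \<in> V"
  shows "(\<Sum>w\<in>V. adj G' u w * q w v) = (\<Sum>w\<in>V. q u w * adj G w v)"
proof -
  consider "u \<in> D" "v \<in> D" | i where "u \<in> D" "v = t i \<or> v = b i"
    | i where "u = t i \<or> u = b i" "v \<in> D" | "u \<in> U" "v \<in> U"
    using assms V_eq in_U_iff by blast
  then show ?thesis
  proof cases
    case 1
    then show ?thesis
      \<comment> \<open>\<open>q_D\<close> would rewrite \<open>q\<close> under the sum and keep the
        collapsing rules from matching.\<close>
      by (simp add: sum_q_col sum_q_row adj_G'_D del: q_D)
  next
    case 2
    then show ?thesis
      by (auto simp: sum_q_col sum_q_row adj_G'_eq_col simp del: q_D)
  next
    case 3
    then show ?thesis
      \<comment> \<open>Symmetry moves \<open>v\<close>, the vertex of \<open>D\<close>, to the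
        front, where \<open>adj_G'_eq_row\<close> applies.\<close>
      by (auto simp: sum_q_col sum_q_row adj_G'_eq_row adj_G'_sym[of _ v] adj_sym[of _ v] simp del: q_D)
  next
    case 4
    \<comment> \<open>Once the sums are collapsed, only deltas of indices remain, and the nine index
      pairs are checked.\<close>
    have "(\<Sum>w\<in>V. adj G' (t i) w * q w (t j)) = (\<Sum>w\<in>V. q (t i) w * adj G w (t j))"
      "(\<Sum>w\<in>V. adj G' (t i) w * q w (b j)) = (\<Sum>w\<in>V. q (t i) w * adj G w (b j))"
      "(\<Sum>w\<in>V. adj G' (b i) w * q w (t j)) = (\<Sum>w\<in>V. q (b i) w * adj G w (t j))"
      "(\<Sum>w\<in>V. adj G' (b i) w * q w (b j)) = (\<Sum>w\<in>V. q (b i) w * adj G w (b j))" for i j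
      by (cases i rule: exhaust_mod3; cases j rule: exhaust_mod3;
          simp add: sum_q_row sum_q_col)+
    then show ?thesis
      using 4 by (auto elim!: U_cases)
  qed
qed

section \<open>The switched graph is simple, and the conclusion\<close>

lemma pverts_G' [simp]: "pverts G' = V"
  by (simp add: switched_graph_def Let_def)

lemma pair_graph_G': "pair_graph G'"
proof -
  interpret pair_graph G
    by (fact graph)
  have fin: "finite V"
    by (fact pair_finite_verts)
  \<comment> \<open>A switched arc joins \<open>D\<close> to \<open>U\<close>, so it cannot be a
    loop.\<close>
  have switch: "v \<in> D \<and> \<pi> w \<in> U" if "(v, w) \<in> switching_arcs G C D" for v w
    using that S_subset_D \<pi>_in_U by (auto simp: switching_arcs_iff)
  have sub: "u \<in> V \<and> v \<in> V \<and> u \<noteq> v" if "(u, v) \<in> parcs G'" for u v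
  proof -
    consider "(u, v) \<in> parcs G" | x where "(u, x) \<in> switching_arcs G C D" "v = \<pi> x"
      | x where "(v, x) \<in> switching_arcs G C D" "u = \<pi> x"
      | "(u, v) \<in> sym_closure {(b 1, b 2), (b 2, b 3), (b 1, b 3), (b 1, t 3), (b 2, t 1), (b 3, t 2)}"
      using \<open>(u, v) \<in> parcs G'\<close> unfolding parcs_G' by (auto simp: sym_closure_def)
    then show ?thesis
    proof cases
      case 1
      then show ?thesis
        using in_arcsD1 in_arcsD2 pair_no_loops by fastforce
    next
      case 2
      then show ?thesis
        using switch[of u x] V_eq U_Int_D by auto
    next
      case 3
      then show ?thesis
        using switch[of v x] V_eq U_Int_D by auto
    next
      case 4
      then show ?thesis
        unfolding V_eq by (auto simp: sym_closure_def)
    qed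
  qed
  show ?thesis
  proof unfold_locales
    show "fst e \<in> pverts G'" "snd e \<in> pverts G'" if "e \<in> parcs G'" for e
      using that sub[of "fst e" "snd e"] by simp_all
    show "fst e \<noteq> snd e" if "e \<in> parcs G'" for e
      using that sub[of "fst e" "snd e"] by simp
    show "finite (pverts G')"
      using fin by simp
    have "parcs G' \<subseteq> V \<times> V"
      using sub by auto
    then show "finite (parcs G')"
      using fin by (blast intro: finite_subset)
    show "symmetric G'"
      using sym_parcs_G' by (simp add: symmetric_def)
  qed
qed

lemma R_cospectral_G': "R_cospectral G' G"
  using pair_graph_G' graph
  by (rule R_cospectral_if_orthogonal[where V = V and q = q])
    (simp_all only: pverts_G' q_orthogonal sum_q adj_intertwine)

end

theorem theorem20:
  fixes G :: "'a pair_pre_digraph"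
    and C :: "3 \<Rightarrow> 'a set"
    and D :: "'a set"
    and t b :: "3 \<Rightarrow> 'a"
    and \<pi> :: "'a \<Rightarrow> 'a"
  assumes "pair_graph G"
    and "pverts G = (\<Union>i. C i) \<union> D"
    and "disjoint_family C"
    and "(\<Union>i. C i) \<inter> D = {}"
    and "\<And>i. C i = {t i, b i}"
    and "\<And>i. card (C i) = 2"
    and "\<And>v i j. v \<in> D \<Longrightarrow>
           [card (neighbours_in G (C i) v) = card (neighbours_in G (C j) v)] (mod 2)"
    and "arcs (with_proj G \<restriction> (\<Union>i. C i)) =
           sym_closure {(b 1, b 2), (b 2, b 3), (b 1, b 3), (b 1, t 2), (b 2, t 3), (b 3, t 1)}"
    and "\<pi> permutes (\<Union>i. C i)"
    and "\<And>i. \<pi> (t i) = t (i - 1)"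
    and "\<And>i. \<pi> (b i) = b (i - 1)"
  shows "R_cospectral (switched_graph G t b \<pi> D) G"
proof -
  interpret triangle_switching G C D t b \<pi>
    using assms(1-8,10,11) by (rule triangle_switching.intro)
  show ?thesis
    by (fact R_cospectral_G')
qed

end
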